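(* Let $x_0\in(0,1)$ and let $(x_n)_{n\ge 0}$ be the real sequence defined by $x_{n+1}=2\,x_n(1-x_n)$ for $n=0,1,2,\ldots$. Then, for all $n\ge 1$, $$x_n-\frac12=-\frac12\,2^{2^n}\left(x_0-\frac12\right)^{2^n}=-\frac12\exp\left\{-n\left[\frac{2^n}{n}\,\bigl|\ln\left[2\left(x_0-1/2\right)\right]\bigr|\right]\right\}.$$
   Context: The recursion is the logistic map $x_{n+1}=r\,x_n(1-x_n)$ with $r=2$, for which $x^*=1/2$ is a fixed point. Here $2^{2^n}$ means $2^{(2^n)}$.
   Formalization: For x_0 ≤ 1/2 the real logarithm ln[2(x_0−1/2)] is undefined; it is read as ln|2(x_0−1/2)| when x_0 < 1/2, and for x_0 = 1/2 the conventions ln 0 = −∞ and exp(−∞) = 0 are used. For x_0 > 1/2 the formula is unchanged. *)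

theory Defs
  imports Complex_Main "HOL-Library.Extended_Real"
begin

text \<open>
  The argument of the logarithm in the closed form ranges over the whole interval from -1 to 1,
  so both functions are needed on more than their classical real domains.
  At 0 the usual conventions ln 0 = -infinity and exp (-infinity) = 0 apply (the library's
  real logarithm has the value 0 there instead). For y < 0 the logarithm is read as ln |y|, which
  is also the library's convention for the real logarithm.
\<close>

definition ext_ln :: "real \<Rightarrow> ereal" where
  "ext_ln y = (if y = 0 then -\<infinity> else ereal (ln \<bar>y\<bar>))"

definition ext_exp :: "ereal \<Rightarrow> ereal" where
  "ext_exp z = (case z of ereal r \<Rightarrow> ereal (exp r) | PInfty \<Rightarrow> \<infinity> | MInfty \<Rightarrow> 0)"

end

(* Under y = 1 - 2 x the map x |-> 2 x (1 - x) becomes squaring, so y_n = y_0^(2^n); for n >= 1 the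
   exponent is even, so the sign of y_0 is lost and only ln |y_0| enters. *)

theory Submission
  imports Defs
begin

text \<open>The coordinate \<open>1 - 2 * x\<close> turns the map into squaring, which gives the
  power form (\<open>logistic_conjugate_square\<close>). For positive \<open>n\<close> the exponent
  \<open>2 ^ n\<close> is even, so passing to \<open>2 * (x 0 - 1/2)\<close>, the negative of the
  initial coordinate, costs nothing, and the power can be written through the logarithm of the
  absolute value (\<open>even_power_eq_ext_exp\<close>).\<close>

lemma logistic_conjugate_square:
  fixes x :: "nat \<Rightarrow> real"
  assumes "\<And>n. x (Suc n) = 2 * x n * (1 - x n)"
  shows "1 - 2 * x n = (1 - 2 * x 0) ^ (2 ^ n)"
proof (induction n)
  case (Suc n)
  have "1 - 2 * x (Suc n) = (1 - 2 * x n)\<^sup>2"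
    by (simp add: assms power2_eq_square algebra_simps)
  also have "\<dots> = (1 - 2 * x 0) ^ (2 ^ Suc n)"
    by (simp only: Suc.IH power_Suc2 power_mult)
  finally show ?case .
qed simp

text \<open>Evenness replaces \<open>y\<close> by its absolute value; the bound by 1 makes the
  logarithm nonpositive, so minus its absolute value is the logarithm itself.\<close>

lemma even_power_eq_ext_exp:
  fixes y :: real
  assumes "\<bar>y\<bar> \<le> 1" "even m" "m > 0"
  shows "ereal (y ^ m) = ext_exp (- (ereal (real m) * \<bar>ext_ln y\<bar>))"
proof (cases "y = 0")
  case True
  \<comment> \<open>Since \<open>m > 0\<close>, the product with infinity is infinite (in
    \<open>ereal\<close>, zero times infinity is 0), so both sides are 0.\<close>
  then show ?thesis
    using assms by (simp add: ext_ln_def ext_exp_def zero_ereal_def)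
next
  case False
  then have "ln \<bar>y\<bar> \<le> 0"
    using assms(1) by simp
  moreover have "y ^ m = exp (real m * ln \<bar>y\<bar>)"
    using False assms(2) by (simp add: exp_of_nat_mult power_even_abs)
  ultimately show ?thesis
    using False by (simp add: ext_ln_def ext_exp_def)
qed

theorem mainTheorem5:
  fixes x :: "nat \<Rightarrow> real"
  assumes "x 0 \<in> {0<..<1}"
    and "\<And>n. x (Suc n) = 2 * x n * (1 - x n)"
  shows "\<forall>n\<ge>1.
      x n - 1/2 = - (1/2) * 2 ^ (2 ^ n) * (x 0 - 1/2) ^ (2 ^ n) \<and>
      ereal (- (1/2) * 2 ^ (2 ^ n) * (x 0 - 1/2) ^ (2 ^ n)) =
        ereal (- (1/2)) *
          ext_exp (- (ereal (real n) * (ereal (2 ^ n / real n) * \<bar>ext_ln (2 * (x 0 - 1/2))\<bar>)))"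
proof (intro allI impI)
  fix n :: nat
  assume n: "n \<ge> 1"
  define y where "y = 2 * (x 0 - 1/2)"
  have even: "even ((2::nat) ^ n)"
    using n by simp
  have scale: "- (1/2) * 2 ^ (2 ^ n) * (x 0 - 1/2) ^ (2 ^ n) = - (1/2) * y ^ (2 ^ n)"
    by (simp only: y_def power_mult_distrib mult.assoc)
  have "1 - 2 * x n = (- y) ^ (2 ^ n)"
    using logistic_conjugate_square [of x n, OF assms(2)] by (simp add: y_def algebra_simps)
  also have "\<dots> = y ^ (2 ^ n)"
    using even by (rule power_minus_even)
  finally have closed: "x n - 1/2 = - (1/2) * y ^ (2 ^ n)"
    by simp
  have "ereal (y ^ (2 ^ n)) = ext_exp (- (ereal (real (2 ^ n)) * \<bar>ext_ln y\<bar>))"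
    using assms(1) even by (intro even_power_eq_ext_exp) (auto simp: y_def)
  also have "ereal (real (2 ^ n)) * \<bar>ext_ln y\<bar>
      = ereal (real n) * (ereal (2 ^ n / real n) * \<bar>ext_ln y\<bar>)"
    using n by (simp add: mult.assoc [symmetric])
  finally have "ereal (- (1/2) * y ^ (2 ^ n)) = ereal (- (1/2)) *
      ext_exp (- (ereal (real n) * (ereal (2 ^ n / real n) * \<bar>ext_ln y\<bar>)))"
    by (metis times_ereal.simps(1))
  then show "x n - 1/2 = - (1/2) * 2 ^ (2 ^ n) * (x 0 - 1/2) ^ (2 ^ n) \<and>
      ereal (- (1/2) * 2 ^ (2 ^ n) * (x 0 - 1/2) ^ (2 ^ n)) =
        ereal (- (1/2)) *
          ext_exp (- (ereal (real n) * (ereal (2 ^ n / real n) * \<bar>ext_ln (2 * (x 0 - 1/2))\<bar>)))"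
    unfolding scale closed y_def [symmetric] by simp
qed

end
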